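(* Let $\mathbf{P}=(p_1,p_2,p_3)$ be a triangle inscribed in the unit circle, with vertices $P_1,P_2,P_3$. Then the symmedian point $S_{\mathbf{P}}$ of $\mathbf{P}$ is $$S_{\mathbf{P}}=\left(\frac{I_{\mathbf{P}}-K_{\mathbf{P}}}{I_{\mathbf{P}}+K_{\mathbf{P}}},\ \frac{2J_{\mathbf{P}}}{I_{\mathbf{P}}+K_{\mathbf{P}}}\right).$$
   Context: The unit circle $\mathbf{O}\subset\mathbb{R}^2$ is identified with $\mathbb{RP}^1=\mathbb{R}\cup\{\infty\}$ by $p\mapsto P=\left(\frac{1-p^2}{1+p^2},\frac{2p}{1+p^2}\right)$, $\infty\mapsto(-1,0)$. A triangle $\mathbf{P}=(p_1,p_2,p_3)$ inscribed in $\mathbf{O}$ is given by three pairwise distinct points $p_\ell\in\mathbb{RP}^1$, with vertices $P_\ell$. With indices modulo $3$, $$I_{\mathbf{P}}=\sum_{\ell=1}^3\frac{1}{p_\ell-p_{\ell+1}},\quad J_{\mathbf{P}}=\frac12\sum_{\ell=1}^3\frac{p_\ell+p_{\ell+1}}{p_\ell-p_{\ell+1}},\quad K_{\mathbf{P}}=\sum_{\ell=1}^3\frac{p_\ell p_{\ell+1}}{p_\ell-p_{\ell+1}},$$ where, if one of the $p_\ell$ is $\infty$, each summand is replaced by its limit. The symmedian point of a triangle with vertices $A,B,C$ and circumcircle $\mathbf{O}$ is the common point of the lines $AA^*$, $BB^*$, $CC^*$, where $A^*$ is the intersection of the tangents to $\mathbf{O}$ at $B$ and $C$ (possibly a point at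 infinity), and $B^*,C^*$ are defined analogously. *)

theory Defs
  imports "HOL-Analysis.Analysis" "HOL-Real_Asymp.Real_Asymp"
begin

type_synonym point = "real \<times> real"

datatype rp1 = Fin_pt real | Inf_pt

fun circle_point :: "rp1 \<Rightarrow> point" where
  "circle_point (Fin_pt p) = ((1 - p\<^sup>2) / (1 + p\<^sup>2), 2 * p / (1 + p\<^sup>2))"
| "circle_point Inf_pt = (-1, 0)"

text \<open>A summand \<open>f p q\<close> extended to the case where one of its arguments is \<open>\<infinity>\<close>.
  The filter \<open>at_infinity\<close> is the neighbourhood filter of \<open>\<infinity>\<close> in the projective line, so
  both signs are covered. The value at \<open>(\<infinity>, \<infinity>)\<close> is a dummy: it never occurs for
  pairwise distinct points.\<close>

fun extend_by_limit :: "(real \<Rightarrow> real \<Rightarrow> real) \<Rightarrow> rp1 \<Rightarrow> rp1 \<Rightarrow> real" where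
  "extend_by_limit f (Fin_pt p) (Fin_pt q) = f p q"
| "extend_by_limit f Inf_pt (Fin_pt q) = Lim at_infinity (\<lambda>x. f x q)"
| "extend_by_limit f (Fin_pt p) Inf_pt = Lim at_infinity (\<lambda>x. f p x)"
| "extend_by_limit f Inf_pt Inf_pt = 0"

definition cyclic_sum :: "(real \<Rightarrow> real \<Rightarrow> real) \<Rightarrow> rp1 \<Rightarrow> rp1 \<Rightarrow> rp1 \<Rightarrow> real" where
  "cyclic_sum f p1 p2 p3 =
     extend_by_limit f p1 p2 + extend_by_limit f p2 p3 + extend_by_limit f p3 p1"

definition tri_I :: "rp1 \<Rightarrow> rp1 \<Rightarrow> rp1 \<Rightarrow> real" where
  "tri_I = cyclic_sum (\<lambda>p q. 1 / (p - q))"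

definition tri_J :: "rp1 \<Rightarrow> rp1 \<Rightarrow> rp1 \<Rightarrow> real" where
  "tri_J p1 p2 p3 = 1 / 2 * cyclic_sum (\<lambda>p q. (p + q) / (p - q)) p1 p2 p3"

definition tri_K :: "rp1 \<Rightarrow> rp1 \<Rightarrow> rp1 \<Rightarrow> real" where
  "tri_K = cyclic_sum (\<lambda>p q. p * q / (p - q))"

text \<open>All the limits used above exist; these are their values.\<close>

lemma summand_limits:
  fixes a :: real
  shows "((\<lambda>x. 1 / (x - a)) \<longlongrightarrow> 0) at_infinity"
    and "((\<lambda>x. 1 / (a - x)) \<longlongrightarrow> 0) at_infinity"
    and "((\<lambda>x. (x + a) / (x - a)) \<longlongrightarrow> 1) at_infinity"
    and "((\<lambda>x. (a + x) / (a - x)) \<longlongrightarrow> -1) at_infinity"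
    and "((\<lambda>x. x * a / (x - a)) \<longlongrightarrow> a) at_infinity"
    and "((\<lambda>x. a * x / (a - x)) \<longlongrightarrow> -a) at_infinity"
  unfolding at_infinity_eq_at_top_bot by (rule filterlim_sup; real_asymp)+

text \<open>The plane is extended by points at infinity, each given by the direction
  (one-dimensional linear subspace) of a family of parallel lines.\<close>

datatype ext_point = Proper point | Ideal "point set"

definition direction :: "point set \<Rightarrow> point set" where
  "direction L = {X - Y | X Y. X \<in> L \<and> Y \<in> L}"

text \<open>Intended for two distinct lines.\<close>

definition lines_meet :: "point set \<Rightarrow> point set \<Rightarrow> ext_point" where
  "lines_meet L M =
     (if L \<inter> M = {} then Ideal (direction L) else Proper (THE X. X \<in> L \<inter> M))"

text \<open>For \<open>A \<noteq> X\<close> the affine hull is the line through both points.\<close>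

fun line_through :: "point \<Rightarrow> ext_point \<Rightarrow> point set" where
  "line_through A (Proper X) = affine hull {A, X}"
| "line_through A (Ideal D) = {A + d | d. d \<in> D}"

text \<open>The tangent to the unit circle at its point \<open>B\<close>: the perpendicular at \<open>B\<close> to the
  radius ending in \<open>B\<close>.\<close>

definition tangent_line :: "point \<Rightarrow> point set" where
  "tangent_line B = {X. (X - B) \<bullet> B = 0}"

definition symmedian_line :: "point \<Rightarrow> point \<Rightarrow> point \<Rightarrow> point set" where
  "symmedian_line A B C = line_through A (lines_meet (tangent_line B) (tangent_line C))"

text \<open>The singleton says that the three lines do have a common point, and only one.\<close>

definition is_symmedian_point :: "point \<Rightarrow> point \<Rightarrow> point \<Rightarrow> point \<Rightarrow> bool" where
  "is_symmedian_point A B C S \<longleftrightarrow>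
     symmedian_line A B C \<inter> symmedian_line B C A \<inter> symmedian_line C A B = {S}"

end

theory Submission
  imports Defs
begin

text \<open>
  Two observations make the formula almost computation-free.

  Geometry. For a point \<open>B\<close> of the unit circle, \<open>1 - X \<bullet> B\<close> is the signed distance of \<open>X\<close> from
  the tangent at \<open>B\<close>. The lines of the pencil spanned by the tangents at \<open>B\<close> and \<open>C\<close> are the
  zero sets of the linear combinations of \<open>1 - X \<bullet> B\<close> and \<open>1 - X \<bullet> C\<close>, whether the tangents
  meet or are parallel (in the latter case one member of the pencil is the line at infinity).
  Hence the symmedian through \<open>A\<close>, the member of that pencil which contains \<open>A\<close>, has the uniform equation \<open>b (1 - X \<bullet> B) = c (1 - X \<bullet> C)\<close>
  (\<open>symmedian_line_equation\<close>), where \<open>a = 1 - B \<bullet> C\<close>, \<open>b = 1 - C \<bullet> A\<close>, \<open>c = 1 - A \<bullet> B\<close> are the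
  halved squares of the side lengths. So the common points of the three symmedians are the
  solutions of \<open>a (1 - X \<bullet> A) = b (1 - X \<bullet> B) = c (1 - X \<bullet> C)\<close>, and the only one is
  \<open>(a A + b B + c C) / (a + b + c)\<close> (\<open>symmedian_point_barycentric\<close>).

  Algebra. Write \<open>p\<^sub>i = x\<^sub>i / y\<^sub>i\<close> in homogeneous coordinates and put
  \<open>d\<^sub>i\<^sub>j = x\<^sub>i y\<^sub>j - x\<^sub>j y\<^sub>i\<close>, \<open>n\<^sub>i = x\<^sub>i\<^sup>2 + y\<^sub>i\<^sup>2\<close>. Then \<open>1 - P\<^sub>i \<bullet> P\<^sub>j = 2 d\<^sub>i\<^sub>j\<^sup>2 / (n\<^sub>i n\<^sub>j)\<close>, so the
  barycentric weight of \<open>P\<^sub>1\<close> is proportional to \<open>n\<^sub>1 d\<^sub>2\<^sub>3\<^sup>2\<close>, and the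
  symmedian point is the sum of the vectors \<open>d\<^sub>2\<^sub>3\<^sup>2 (y\<^sub>1\<^sup>2 - x\<^sub>1\<^sup>2, 2 x\<^sub>1 y\<^sub>1)\<close> divided by the sum of
  the numbers \<open>d\<^sub>2\<^sub>3\<^sup>2 (y\<^sub>1\<^sup>2 + x\<^sub>1\<^sup>2)\<close>, both over the cyclic shifts. On the other hand, the vectors
  \<open>(x\<^sub>i, y\<^sub>i)\<close> satisfy the linear relation with coefficients \<open>d\<^sub>2\<^sub>3, d\<^sub>3\<^sub>1, d\<^sub>1\<^sub>2\<close>; multiplying two
  of its coordinates shows that \<open>I\<close>, \<open>J\<close>, \<open>K\<close> are, up to the common factor
  \<open>-1 / (2 d\<^sub>1\<^sub>2 d\<^sub>2\<^sub>3 d\<^sub>3\<^sub>1)\<close>, the sums of \<open>d\<^sub>2\<^sub>3\<^sup>2 y\<^sub>1\<^sup>2\<close>, \<open>d\<^sub>2\<^sub>3\<^sup>2 x\<^sub>1 y\<^sub>1\<close> and \<open>d\<^sub>2\<^sub>3\<^sup>2 x\<^sub>1\<^sup>2\<close>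
  (\<open>cyclic_sum_product_over_det\<close>). In particular \<open>I + K\<close> is a nonzero multiple of a sum of
  positive numbers.
\<close>

section \<open>The symmedians of a triangle inscribed in the unit circle\<close>

lemma inner_unit_less_1:
  fixes A B :: point
  assumes "A \<bullet> A = 1" "B \<bullet> B = 1" "A \<noteq> B"
  shows "A \<bullet> B < 1"
proof -
  have "(A - B) \<bullet> (A - B) > 0" using assms by simp
  then show ?thesis using assms by (simp add: inner_diff inner_commute)
qed

lemma orthogonal_to_basis_eq_0:
  fixes U V W :: point
  assumes "fst U * snd V - snd U * fst V \<noteq> 0" "W \<bullet> U = 0" "W \<bullet> V = 0"
  shows "W = 0"
proof -
  have "fst W * (fst U * snd V - snd U * fst V) = 0" "snd W * (fst U * snd V - snd U * fst V) = 0"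
    using assms(2,3) by (simp_all add: inner_prod_def) algebra+
  then show ?thesis using assms(1) by (simp add: prod_eq_iff)
qed

lemma orthogonal_to_unit_vectors_eq_0:
  fixes B C W :: point
  assumes "B \<bullet> B = 1" "C \<bullet> C = 1" "B \<noteq> C" "B \<noteq> - C" "W \<bullet> B = 0" "W \<bullet> C = 0"
  shows "W = 0"
proof (rule orthogonal_to_basis_eq_0[OF _ assms(5,6)])
  have "B \<bullet> C < 1" "B \<bullet> (- C) < 1"
    using assms inner_unit_less_1[of B C] inner_unit_less_1[of B "- C"] by simp_all
  then have "(1 - B \<bullet> C) * (1 + B \<bullet> C) \<noteq> 0" by simp
  moreover have "(1 - B \<bullet> C) * (1 + B \<bullet> C) = (fst B * snd C - snd B * fst C)\<^sup>2"
    using assms(1,2) by (simp add: inner_prod_def) algebra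
  ultimately show "fst B * snd C - snd B * fst C \<noteq> 0" by simp
qed

lemma tangent_line_unit:
  assumes "B \<bullet> B = 1"
  shows "tangent_line B = {X. X \<bullet> B = 1}"
  using assms by (simp add: tangent_line_def inner_diff_left)

lemma lines_meet_antipodal_tangents:
  fixes B :: point
  assumes "B \<bullet> B = 1"
  shows "lines_meet (tangent_line B) (tangent_line (- B)) = Ideal {D. D \<bullet> B = 0}"
proof -
  have "tangent_line B \<inter> tangent_line (- B) = {}"
    using assms by (auto simp: tangent_line_unit)
  moreover have "direction (tangent_line B) = {D. D \<bullet> B = 0}"
  proof (intro equalityI subsetI)
    fix D assume "D \<in> {D. D \<bullet> B = 0}"
    then have "D = (B + D) - B" "B + D \<in> tangent_line B" "B \<in> tangent_line B"
      using assms by (simp_all add: tangent_line_unit inner_add_left)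
    then show "D \<in> direction (tangent_line B)" unfolding direction_def by blast
  next
    fix D assume "D \<in> direction (tangent_line B)"
    then obtain X Y where "D = X - Y" "X \<bullet> B = 1" "Y \<bullet> B = 1"
      unfolding direction_def tangent_line_unit[OF assms] by blast
    then show "D \<in> {D. D \<bullet> B = 0}" by (simp add: inner_diff_left)
  qed
  ultimately show ?thesis by (simp add: lines_meet_def)
qed

lemma lines_meet_tangents:
  fixes B C :: point
  assumes B: "B \<bullet> B = 1" and C: "C \<bullet> C = 1" and "B \<noteq> C" "B \<noteq> - C"
  obtains T where "lines_meet (tangent_line B) (tangent_line C) = Proper T"
    "T \<bullet> B = 1" "T \<bullet> C = 1"
proof -
  have "B \<bullet> (- C) < 1" using assms inner_unit_less_1[of B "- C"] by simp
  then have nz: "1 + B \<bullet> C \<noteq> 0" by simp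
  define T where "T = (1 / (1 + B \<bullet> C)) *\<^sub>R (B + C)"
  have T: "T \<bullet> B = 1" "T \<bullet> C = 1"
    using nz B C by (simp_all add: T_def inner_add_left inner_commute[of C B] add.commute)
  have "X = T" if "X \<bullet> B = 1" "X \<bullet> C = 1" for X
    using orthogonal_to_unit_vectors_eq_0[of B C "X - T"] assms that T
    by (simp add: inner_diff_left)
  then have "tangent_line B \<inter> tangent_line C = {T}"
    unfolding tangent_line_unit[OF B] tangent_line_unit[OF C] using T by blast
  then show ?thesis using that T by (simp add: lines_meet_def)
qed

text \<open>The right-hand side is the line through \<open>A\<close> in the pencil spanned by the two tangents. If
  the tangents meet in \<open>T\<close>, then \<open>X = u A + (1 - u) T\<close> forces \<open>1 - X \<bullet> B = u (1 - A \<bullet> B)\<close> and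
  \<open>1 - X \<bullet> C = u (1 - A \<bullet> C)\<close>, and conversely these two numbers determine \<open>X\<close>, as \<open>B\<close> and \<open>C\<close>
  are linearly independent. If the tangents are parallel, both sides say that \<open>X \<bullet> B = A \<bullet> B\<close>.\<close>

lemma symmedian_line_equation:
  fixes A B C :: point
  assumes A: "A \<bullet> A = 1" and B: "B \<bullet> B = 1" and C: "C \<bullet> C = 1"
    and ne: "A \<noteq> B" "B \<noteq> C" "C \<noteq> A"
  shows "symmedian_line A B C = {X. (1 - A \<bullet> C) * (1 - X \<bullet> B) = (1 - A \<bullet> B) * (1 - X \<bullet> C)}"
proof (cases "B = - C")
  case True
  then have C_eq: "C = - B" by simp
  have "symmedian_line A B C = {X. X \<bullet> B = A \<bullet> B}"
  proof (intro equalityI subsetI)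
    fix X assume "X \<in> {X. X \<bullet> B = A \<bullet> B}"
    then have "X = A + (X - A)" "(X - A) \<bullet> B = 0" by (simp_all add: inner_diff_left)
    then show "X \<in> symmedian_line A B C"
      unfolding symmedian_line_def C_eq lines_meet_antipodal_tangents[OF B] line_through.simps
      by blast
  qed (auto simp: symmedian_line_def C_eq lines_meet_antipodal_tangents[OF B] inner_add_left)
  also have "\<dots> = {X. (1 - A \<bullet> C) * (1 - X \<bullet> B) = (1 - A \<bullet> B) * (1 - X \<bullet> C)}"
    by (auto simp: C_eq algebra_simps)
  finally show ?thesis .
next
  case False
  then obtain T where meet: "lines_meet (tangent_line B) (tangent_line C) = Proper T"
    and T: "T \<bullet> B = 1" "T \<bullet> C = 1"
    using lines_meet_tangents[OF B C ne(2)] by blast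
  have pos: "1 - A \<bullet> B > 0" "1 - A \<bullet> C > 0"
    using inner_unit_less_1[OF A B] inner_unit_less_1[OF A C] ne by auto
  have line: "symmedian_line A B C = {u *\<^sub>R A + v *\<^sub>R T | u v. u + v = 1}"
    by (simp add: symmedian_line_def meet affine_hull_2)
  show ?thesis
  proof (intro equalityI subsetI)
    fix X assume "X \<in> symmedian_line A B C"
    then obtain u v where "u + v = 1" and X: "X = u *\<^sub>R A + v *\<^sub>R T" unfolding line by blast
    then have v: "v = 1 - u" by simp
    have "1 - X \<bullet> B = u * (1 - A \<bullet> B)" "1 - X \<bullet> C = u * (1 - A \<bullet> C)"
      unfolding X v using T by (simp_all add: inner_add_left algebra_simps)
    then show "X \<in> {X. (1 - A \<bullet> C) * (1 - X \<bullet> B) = (1 - A \<bullet> B) * (1 - X \<bullet> C)}" by simp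
  next
    fix X assume "X \<in> {X. (1 - A \<bullet> C) * (1 - X \<bullet> B) = (1 - A \<bullet> B) * (1 - X \<bullet> C)}"
    then have eq: "(1 - A \<bullet> C) * (1 - X \<bullet> B) = (1 - A \<bullet> B) * (1 - X \<bullet> C)" by simp
    define u where "u = (1 - X \<bullet> B) / (1 - A \<bullet> B)"
    have u: "u * (1 - A \<bullet> B) = 1 - X \<bullet> B" "u * (1 - A \<bullet> C) = 1 - X \<bullet> C"
      unfolding u_def times_divide_eq_left
      using pos eq by (simp_all add: nonzero_divide_eq_eq mult.commute)
    define Y where "Y = u *\<^sub>R A + (1 - u) *\<^sub>R T"
    have "(X - Y) \<bullet> B = 0" "(X - Y) \<bullet> C = 0"
      using T u by (simp_all add: Y_def inner_add_left inner_diff_left algebra_simps)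
    then have "X - Y = 0"
      using orthogonal_to_unit_vectors_eq_0[OF B C ne(2) False] by blast
    then show "X \<in> symmedian_line A B C" unfolding line Y_def by force
  qed
qed

section \<open>The symmedian point in barycentric coordinates\<close>

text \<open>The determinant below is, up to sign, twice the area. As the circumradius
  is \<open>1\<close>, twice the area is half the product of the three side lengths.\<close>

lemma inscribed_triangle_nondegenerate:
  fixes A B C :: point
  assumes A: "A \<bullet> A = 1" and B: "B \<bullet> B = 1" and C: "C \<bullet> C = 1"
    and ne: "A \<noteq> B" "B \<noteq> C" "C \<noteq> A"
  shows "fst (A - B) * snd (A - C) - snd (A - B) * fst (A - C) \<noteq> 0"
proof -
  \<comment> \<open>The Gram determinant of three vectors of the plane vanishes.\<close>
  have "(A \<bullet> A) * (B \<bullet> B) * (C \<bullet> C) + 2 * (A \<bullet> B) * (B \<bullet> C) * (C \<bullet> A)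
      - (A \<bullet> A) * (B \<bullet> C)\<^sup>2 - (B \<bullet> B) * (C \<bullet> A)\<^sup>2 - (C \<bullet> C) * (A \<bullet> B)\<^sup>2 = 0"
    unfolding inner_prod_def inner_real_def by algebra
  then have gram: "1 + 2 * (A \<bullet> B) * (B \<bullet> C) * (C \<bullet> A) - (B \<bullet> C)\<^sup>2 - (C \<bullet> A)\<^sup>2 - (A \<bullet> B)\<^sup>2 = 0"
    by (simp add: A B C)
  have "(fst (A - B) * snd (A - C) - snd (A - B) * fst (A - C))\<^sup>2
    = ((A - B) \<bullet> (A - B)) * ((A - C) \<bullet> (A - C)) - ((A - B) \<bullet> (A - C))\<^sup>2"
    unfolding inner_prod_def inner_real_def by algebra
  also have "\<dots> = (2 - 2 * (A \<bullet> B)) * (2 - 2 * (C \<bullet> A)) - (1 - A \<bullet> B - C \<bullet> A + B \<bullet> C)\<^sup>2"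
    by (simp add: inner_diff A B C inner_commute algebra_simps)
  also have "\<dots> = 2 * (1 - A \<bullet> B) * (1 - B \<bullet> C) * (1 - C \<bullet> A)"
    using gram by algebra
  finally have "(fst (A - B) * snd (A - C) - snd (A - B) * fst (A - C))\<^sup>2
    = 2 * (1 - A \<bullet> B) * (1 - B \<bullet> C) * (1 - C \<bullet> A)" .
  moreover have "(1 - A \<bullet> B) * (1 - B \<bullet> C) * (1 - C \<bullet> A) > 0"
    using inner_unit_less_1[OF A B] inner_unit_less_1[OF B C] inner_unit_less_1[OF C A] ne
    by simp
  ultimately show ?thesis by auto
qed

text \<open>At the point \<open>S\<close> the three numbers \<open>a (1 - S \<bullet> A)\<close>, \<open>b (1 - S \<bullet> B)\<close>, \<open>c (1 - S \<bullet> C)\<close> all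
  equal \<open>2 a b c / (a + b + c)\<close>. For another common point \<open>X\<close> the distances from the tangents
  are those of \<open>S\<close> times some \<open>r\<close>, so that \<open>X - r S\<close> has the same inner product \<open>1 - r\<close> with
  the three vertices. As these are not collinear, \<open>X - r S = 0\<close>, hence \<open>r = 1\<close>.\<close>

lemma symmedian_point_barycentric:
  fixes A B C S :: point and a b c :: real
  assumes A: "A \<bullet> A = 1" and B: "B \<bullet> B = 1" and C: "C \<bullet> C = 1"
    and ne: "A \<noteq> B" "B \<noteq> C" "C \<noteq> A"
    and a: "a = 1 - B \<bullet> C" and b: "b = 1 - C \<bullet> A" and c: "c = 1 - A \<bullet> B"
    and S: "(a + b + c) *\<^sub>R S = a *\<^sub>R A + b *\<^sub>R B + c *\<^sub>R C"
  shows "is_symmedian_point A B C S"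
proof -
  define s where "s = a + b + c"
  have pos: "a > 0" "b > 0" "c > 0"
    using inner_unit_less_1[OF B C] inner_unit_less_1[OF C A] inner_unit_less_1[OF A B] ne
    by (simp_all add: a b c)
  then have s: "s > 0" by (simp add: s_def)
  have inner: "A \<bullet> B = 1 - c" "B \<bullet> A = 1 - c" "B \<bullet> C = 1 - a" "C \<bullet> B = 1 - a"
    "C \<bullet> A = 1 - b" "A \<bullet> C = 1 - b"
    by (simp_all add: a b c inner_commute)
  have lines: "X \<in> symmedian_line A B C \<inter> symmedian_line B C A \<inter> symmedian_line C A B \<longleftrightarrow>
      b * (1 - X \<bullet> B) = c * (1 - X \<bullet> C) \<and> c * (1 - X \<bullet> C) = a * (1 - X \<bullet> A)" for X
    unfolding symmedian_line_equation[OF A B C ne]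
      symmedian_line_equation[OF B C A ne(2,3,1)] symmedian_line_equation[OF C A B ne(3,1,2)]
    by (auto simp: inner)
  have "s * (S \<bullet> V) = a * (A \<bullet> V) + b * (B \<bullet> V) + c * (C \<bullet> V)" for V
    using arg_cong[OF S, of "\<lambda>W. W \<bullet> V"] by (simp add: s_def inner_add_left)
  then have "s * (S \<bullet> A) = s - 2 * b * c" "s * (S \<bullet> B) = s - 2 * a * c"
      "s * (S \<bullet> C) = s - 2 * a * b"
    by (simp_all add: A B C inner s_def algebra_simps)
  then have dist: "1 - S \<bullet> A = 2 * b * c / s" "1 - S \<bullet> B = 2 * a * c / s"
      "1 - S \<bullet> C = 2 * a * b / s"
    using s by (simp_all add: field_simps)
  then have S_eqs: "b * (1 - S \<bullet> B) = c * (1 - S \<bullet> C)" "c * (1 - S \<bullet> C) = a * (1 - S \<bullet> A)"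
    by simp_all
  have uniq: "X = S" if X: "b * (1 - X \<bullet> B) = c * (1 - X \<bullet> C)" "c * (1 - X \<bullet> C) = a * (1 - X \<bullet> A)" for X
  proof -
    define k where "k = a * (1 - X \<bullet> A)"
    have k: "1 - X \<bullet> A = k / a" "1 - X \<bullet> B = k / b" "1 - X \<bullet> C = k / c"
      using X pos by (simp_all add: k_def eq_divide_eq mult.commute)
    define r where "r = s * k / (2 * a * b * c)"
    have r: "1 - X \<bullet> A = r * (1 - S \<bullet> A)" "1 - X \<bullet> B = r * (1 - S \<bullet> B)"
        "1 - X \<bullet> C = r * (1 - S \<bullet> C)"
      unfolding dist k r_def using pos s by simp_all
    define W where "W = X - r *\<^sub>R S"
    have W: "W \<bullet> A = 1 - r" "W \<bullet> B = 1 - r" "W \<bullet> C = 1 - r"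
      using r by (simp_all add: W_def inner_diff_left algebra_simps)
    have "W = 0"
      by (rule orthogonal_to_basis_eq_0[OF inscribed_triangle_nondegenerate[OF A B C ne]])
        (simp_all add: inner_diff_right W)
    then show "X = S" using W(1) by (simp add: W_def)
  qed
  show ?thesis
    unfolding is_symmedian_point_def
  proof (intro equalityI subsetI)
    fix X assume "X \<in> symmedian_line A B C \<inter> symmedian_line B C A \<inter> symmedian_line C A B"
    then show "X \<in> {S}" using lines uniq by blast
  next
    fix X assume "X \<in> {S}"
    then show "X \<in> symmedian_line A B C \<inter> symmedian_line B C A \<inter> symmedian_line C A B"
      using lines S_eqs by blast
  qed
qed

section \<open>Homogeneous coordinates on the circle\<close>

fun num :: "rp1 \<Rightarrow> real" where
  "num (Fin_pt p) = p"
| "num Inf_pt = 1"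

fun den :: "rp1 \<Rightarrow> real" where
  "den (Fin_pt p) = 1"
| "den Inf_pt = 0"

definition sqnorm :: "rp1 \<Rightarrow> real" where
  "sqnorm p = (num p)\<^sup>2 + (den p)\<^sup>2"

definition det2 :: "rp1 \<Rightarrow> rp1 \<Rightarrow> real" where
  "det2 p q = num p * den q - num q * den p"

lemma sqnorm_pos: "sqnorm p > 0"
  by (cases p) (simp_all add: sqnorm_def add_nonneg_pos)

lemma det2_nonzero: "p \<noteq> q \<Longrightarrow> det2 p q \<noteq> 0"
  by (cases p; cases q) (simp_all add: det2_def)

lemma circle_point_homogeneous:
  "circle_point p = (((den p)\<^sup>2 - (num p)\<^sup>2) / sqnorm p, 2 * num p * den p / sqnorm p)"
  by (cases p) (simp_all add: sqnorm_def add.commute)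

lemma scaled_circle_point:
  "sqnorm p *\<^sub>R circle_point p = ((den p)\<^sup>2 - (num p)\<^sup>2, 2 * num p * den p)"
  using sqnorm_pos[of p] by (simp add: circle_point_homogeneous)

text \<open>Half the squared length of a chord: in angles, \<open>1 - cos (2 \<theta>) = 2 (sin \<theta>)\<^sup>2\<close>.\<close>

lemma one_minus_inner_circle_point:
  "1 - circle_point p \<bullet> circle_point q = 2 * (det2 p q)\<^sup>2 / (sqnorm p * sqnorm q)"
proof -
  have "sqnorm p * sqnorm q - (((den p)\<^sup>2 - (num p)\<^sup>2) * ((den q)\<^sup>2 - (num q)\<^sup>2)
      + 2 * num p * den p * (2 * num q * den q)) = 2 * (det2 p q)\<^sup>2"
    unfolding sqnorm_def det2_def by algebra
  moreover have "circle_point p \<bullet> circle_point q = (((den p)\<^sup>2 - (num p)\<^sup>2) * ((den q)\<^sup>2 - (num q)\<^sup>2)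
      + 2 * num p * den p * (2 * num q * den q)) / (sqnorm p * sqnorm q)"
    by (simp add: circle_point_homogeneous inner_prod_def add_divide_distrib)
  ultimately show ?thesis
    using sqnorm_pos[of p] sqnorm_pos[of q] by (simp add: field_simps)
qed

lemma inner_circle_point_self: "circle_point p \<bullet> circle_point p = 1"
  using one_minus_inner_circle_point[of p p] by (simp add: det2_def)

lemma circle_point_inject:
  assumes "p \<noteq> q"
  shows "circle_point p \<noteq> circle_point q"
proof
  assume "circle_point p = circle_point q"
  then have "2 * (det2 p q)\<^sup>2 / (sqnorm p * sqnorm q) = 0"
    using one_minus_inner_circle_point[of p q] by (simp add: inner_circle_point_self)
  then show False using det2_nonzero[OF assms] sqnorm_pos[of p] sqnorm_pos[of q] by simp
qed

section \<open>The three cyclic sums\<close>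

lemmas Lim_summand = summand_limits[THEN tendsto_Lim[OF trivial_limit_at_infinity]]

lemma summand_homogeneous:
  assumes "p \<noteq> q"
  shows "extend_by_limit (\<lambda>p q. 1 / (p - q)) p q = den p * den q / det2 p q"
    and "extend_by_limit (\<lambda>p q. (p + q) / (p - q)) p q =
      (num p * den q + den p * num q) / det2 p q"
    and "extend_by_limit (\<lambda>p q. p * q / (p - q)) p q = num p * num q / det2 p q"
  using assms by (cases p; cases q; simp add: det2_def Lim_summand)+

text \<open>With \<open>f = g = den\<close> the left-hand side is twice the sum \<open>I\<close>, with \<open>f = g = num\<close> twice the sum
  \<open>K\<close>, and with one of each it is twice the sum \<open>J\<close>. The two assumptions are the
  coordinates of the linear relation between three vectors of the plane. Multiply them and divide
  by \<open>d\<^sub>1\<^sub>2 d\<^sub>2\<^sub>3 d\<^sub>3\<^sub>1\<close>: the mixed terms give the left-hand side, and the diagonal terms give the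
  negative of the right-hand side.\<close>

lemma cyclic_sum_product_over_det:
  fixes f g :: "rp1 \<Rightarrow> real"
  assumes "p1 \<noteq> p2" "p2 \<noteq> p3" "p3 \<noteq> p1"
    and f: "det2 p2 p3 * f p1 + det2 p3 p1 * f p2 + det2 p1 p2 * f p3 = 0"
    and g: "det2 p2 p3 * g p1 + det2 p3 p1 * g p2 + det2 p1 p2 * g p3 = 0"
  shows "(f p1 * g p2 + g p1 * f p2) / det2 p1 p2 + (f p2 * g p3 + g p2 * f p3) / det2 p2 p3
      + (f p3 * g p1 + g p3 * f p1) / det2 p3 p1
    = - ((det2 p2 p3)\<^sup>2 * (f p1 * g p1) + (det2 p3 p1)\<^sup>2 * (f p2 * g p2)
        + (det2 p1 p2)\<^sup>2 * (f p3 * g p3)) / (det2 p1 p2 * det2 p2 p3 * det2 p3 p1)"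
proof -
  define d1 d2 d3 where d: "d1 = det2 p2 p3" "d2 = det2 p3 p1" "d3 = det2 p1 p2"
  have nz: "d1 \<noteq> 0" "d2 \<noteq> 0" "d3 \<noteq> 0" using assms by (simp_all add: d det2_nonzero)
  have "(f p1 * g p2 + g p1 * f p2) * (d1 * d2) + (f p2 * g p3 + g p2 * f p3) * (d2 * d3)
      + (f p3 * g p1 + g p3 * f p1) * (d3 * d1)
    = - (d1\<^sup>2 * (f p1 * g p1) + d2\<^sup>2 * (f p2 * g p2) + d3\<^sup>2 * (f p3 * g p3))"
    using f g unfolding d[symmetric] by algebra
  moreover have "u / d3 + v / d1 + w / d2 = (u * (d1 * d2) + v * (d2 * d3) + w * (d3 * d1))
      / (d3 * d1 * d2)" for u v w
    using nz by (simp add: field_simps)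
  ultimately show ?thesis unfolding d[symmetric] by metis
qed

theorem theorem3p1:
  fixes p1 p2 p3 :: rp1
  assumes "p1 \<noteq> p2" and "p2 \<noteq> p3" and "p3 \<noteq> p1"
  shows "tri_I p1 p2 p3 + tri_K p1 p2 p3 \<noteq> 0 \<and>
    is_symmedian_point (circle_point p1) (circle_point p2) (circle_point p3)
      ((tri_I p1 p2 p3 - tri_K p1 p2 p3) / (tri_I p1 p2 p3 + tri_K p1 p2 p3),
       2 * tri_J p1 p2 p3 / (tri_I p1 p2 p3 + tri_K p1 p2 p3))"
proof -
  define d1 d2 d3 where d: "d1 = det2 p2 p3" "d2 = det2 p3 p1" "d3 = det2 p1 p2"
  have nz: "d1 \<noteq> 0" "d2 \<noteq> 0" "d3 \<noteq> 0" using assms by (simp_all add: d det2_nonzero)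
  define m where "m = - 1 / (2 * (d3 * d1 * d2))"
  have m: "m \<noteq> 0" using nz by (simp add: m_def)
  have scale: "- x / (d3 * d1 * d2) = 2 * (m * x)" for x by (simp add: m_def)
  define Q where "Q f = d1\<^sup>2 * f p1 + d2\<^sup>2 * f p2 + d3\<^sup>2 * f p3" for f :: "rp1 \<Rightarrow> real"

  have num: "det2 p2 p3 * num p1 + det2 p3 p1 * num p2 + det2 p1 p2 * num p3 = 0"
    and den: "det2 p2 p3 * den p1 + det2 p3 p1 * den p2 + det2 p1 p2 * den p3 = 0"
    unfolding det2_def by algebra+
  note product = cyclic_sum_product_over_det[OF assms]
  have "2 * tri_I p1 p2 p3 = - Q (\<lambda>p. den p * den p) / (d3 * d1 * d2)"
    using product[OF den den]
    by (simp add: tri_I_def cyclic_sum_def summand_homogeneous assms d Q_def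
        mult.commute[of "den p3" "den p1"])
  then have I: "tri_I p1 p2 p3 = m * Q (\<lambda>p. (den p)\<^sup>2)"
    unfolding scale by (simp add: power2_eq_square)
  have "2 * tri_K p1 p2 p3 = - Q (\<lambda>p. num p * num p) / (d3 * d1 * d2)"
    using product[OF num num]
    by (simp add: tri_K_def cyclic_sum_def summand_homogeneous assms d Q_def
        mult.commute[of "num p3" "num p1"])
  then have K: "tri_K p1 p2 p3 = m * Q (\<lambda>p. (num p)\<^sup>2)"
    unfolding scale by (simp add: power2_eq_square)
  have "2 * tri_J p1 p2 p3 = cyclic_sum (\<lambda>p q. (p + q) / (p - q)) p1 p2 p3"
    by (simp add: tri_J_def)
  also have "\<dots> = - Q (\<lambda>p. num p * den p) / (d3 * d1 * d2)"
    using product[OF num den]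
    by (simp only: cyclic_sum_def summand_homogeneous assms d Q_def not_False_eq_True)
  finally have "2 * tri_J p1 p2 p3 = - Q (\<lambda>p. num p * den p) / (d3 * d1 * d2)" .
  then have J: "tri_J p1 p2 p3 = m * Q (\<lambda>p. num p * den p)"
    unfolding scale by simp
  have IK: "tri_I p1 p2 p3 + tri_K p1 p2 p3 = m * Q sqnorm"
    and IK': "tri_I p1 p2 p3 - tri_K p1 p2 p3 = m * Q (\<lambda>p. (den p)\<^sup>2 - (num p)\<^sup>2)"
    and J': "2 * tri_J p1 p2 p3 = m * Q (\<lambda>p. 2 * num p * den p)"
    by (simp_all add: I J K Q_def sqnorm_def algebra_simps)
  have Q_pos: "Q sqnorm > 0"
    unfolding Q_def using nz by (intro add_pos_pos mult_pos_pos sqnorm_pos) simp_all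

  define S where "S = (Q (\<lambda>p. (den p)\<^sup>2 - (num p)\<^sup>2) / Q sqnorm, Q (\<lambda>p. 2 * num p * den p) / Q sqnorm)"
  have S_sum: "Q sqnorm *\<^sub>R S = (d1\<^sup>2 * sqnorm p1) *\<^sub>R circle_point p1
      + (d2\<^sup>2 * sqnorm p2) *\<^sub>R circle_point p2 + (d3\<^sup>2 * sqnorm p3) *\<^sub>R circle_point p3"
    using Q_pos
    by (simp only: scaleR_scaleR[symmetric] scaled_circle_point) (simp add: S_def Q_def)

  \<comment> \<open>Passing from \<open>d\<^sub>2\<^sub>3\<^sup>2 n\<^sub>1\<close> to the weight \<open>a = 2 d\<^sub>2\<^sub>3\<^sup>2 / (n\<^sub>2 n\<^sub>3)\<close> divides by the symmetric
    number \<open>n\<^sub>1 n\<^sub>2 n\<^sub>3 / 2\<close>.\<close>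
  define k where "k = 2 / (sqnorm p1 * sqnorm p2 * sqnorm p3)"
  have weights: "k * (d1\<^sup>2 * sqnorm p1) = 1 - circle_point p2 \<bullet> circle_point p3"
    "k * (d2\<^sup>2 * sqnorm p2) = 1 - circle_point p3 \<bullet> circle_point p1"
    "k * (d3\<^sup>2 * sqnorm p3) = 1 - circle_point p1 \<bullet> circle_point p2"
    using sqnorm_pos[of p1] sqnorm_pos[of p2] sqnorm_pos[of p3]
    by (simp_all add: k_def one_minus_inner_circle_point d field_simps)
  have "is_symmedian_point (circle_point p1) (circle_point p2) (circle_point p3) S"
  proof (rule symmedian_point_barycentric[OF _ _ _ _ _ _ weights])
    show "(k * (d1\<^sup>2 * sqnorm p1) + k * (d2\<^sup>2 * sqnorm p2) + k * (d3\<^sup>2 * sqnorm p3)) *\<^sub>R S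
      = (k * (d1\<^sup>2 * sqnorm p1)) *\<^sub>R circle_point p1 + (k * (d2\<^sup>2 * sqnorm p2)) *\<^sub>R circle_point p2
        + (k * (d3\<^sup>2 * sqnorm p3)) *\<^sub>R circle_point p3"
      using arg_cong[OF S_sum, of "scaleR k"]
      by (simp add: Q_def scaleR_add_right distrib_left)
  qed (use assms in \<open>simp_all add: inner_circle_point_self circle_point_inject\<close>)
  then show ?thesis using m Q_pos by (simp add: IK IK' J' S_def)
qed

end
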